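(* Let $Y$ be a real random variable whose moment generating function $E[e^{tY}]$ exists for $|t|<r$, for some $r>0$. Then for any integers $n,k$ with $n\ge k\ge 0$ and every real $x$, $$\left(\frac{d}{dx}\right)^{k}B_{n}^{(L,Y)}(x)=k!\sum_{j=0}^{n-k}\binom{n}{j}B_{j}^{(L,Y)}(x)L_{Y}(n-j,k).$$ In particular, for $k=1$ and every integer $n\ge 1$, $$\frac{d}{dx}B_{n}^{(L,Y)}(x)=\sum_{j=0}^{n-1}\binom{n}{j}E\big[\langle Y\rangle_{n-j}\big]B_{j}^{(L,Y)}(x).$$
   Context: Rising factorial: $\langle x\rangle_0=1$, $\langle x\rangle_n=x(x+1)\cdots(x+n-1)$ for $n\ge 1$. The probabilistic Lah numbers $L_Y(n,k)$ ($n\ge k\ge 0$) associated with $Y$ are defined by the power series expansion about $t=0$ $$\frac{1}{k!}\left(E\left[\left(\frac{1}{1-t}\right)^{Y}\right]-1\right)^{k}=\sum_{n=k}^{\infty}L_{Y}(n,k)\frac{t^{n}}{n!},\quad k\ge 0.$$ The probabilistic Lah-Bell polynomials associated with $Y$ are $B_{n}^{(L,Y)}(x)=\sum_{k=0}^{n}L_{Y}(n,k)x^{k}$, $n\ge 0$. *)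

theory Defs
  imports "HOL-Probability.Probability" "HOL-Analysis.FPS_Convergence"
begin

text \<open>
  The generating function is only considered near \<open>t = 0\<close>, where \<open>1 / (1 - t) > 0\<close>, so the
  real power is \<open>powr\<close>. A convergent power series expansion about \<open>0\<close> is unique, whence the
  definite description; the coefficients with \<open>n < k\<close> vanish because the base of the
  \<open>k\<close>-th power is \<open>0\<close> at \<open>t = 0\<close>.
\<close>

definition prob_lah :: "'a measure \<Rightarrow> ('a \<Rightarrow> real) \<Rightarrow> nat \<Rightarrow> nat \<Rightarrow> real" where
  "prob_lah M Y n k =
     fact n * fps_nth (THE F. (\<lambda>t. 1 / fact k *
       ((\<integral>\<omega>. (1 / (1 - t)) powr Y \<omega> \<partial>M) - 1) ^ k) has_fps_expansion F) n"

definition prob_lah_bell :: "'a measure \<Rightarrow> ('a \<Rightarrow> real) \<Rightarrow> nat \<Rightarrow> real \<Rightarrow> real" where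
  "prob_lah_bell M Y n x = (\<Sum>k=0..n. prob_lah M Y n k * x ^ k)"

end

theory Submission
  imports Defs "HOL-Complex_Analysis.Laurent_Convergence"
begin

text \<open>
  By the binomial series, \<open>(1 - t) powr (- Y)\<close> has the coefficients \<open>\<langle>Y\<rangle>\<^sub>n / n!\<close>. Its term-wise
  absolute values sum to at most \<open>(1 - \<bar>t\<bar>) powr (- \<bar>Y\<bar>)\<close>, which is integrable for small \<open>t\<close>
  by the assumption on the moment generating function; hence the expectation is analytic at \<open>0\<close>
  with coefficients \<open>E \<langle>Y\<rangle>\<^sub>n / n!\<close>. Writing \<open>H\<close> for this series without its constant term \<open>1\<close>,
  the numbers \<open>L(n, k) / n!\<close> are the coefficients of \<open>H ^ k / k!\<close>, so that the \<open>B\<^sub>n(x) / n!\<close>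
  are those of \<open>exp (x H)\<close>. Differentiating \<open>k\<close> times in \<open>x\<close> multiplies this by \<open>H ^ k\<close>, and the
  claim is the resulting Cauchy product.
\<close>

lemma abs_pochhammer_le: "\<bar>pochhammer (y :: real) n\<bar> \<le> pochhammer \<bar>y\<bar> n"
  unfolding pochhammer_prod abs_prod by (intro prod_mono) auto

lemma pochhammer_series_sums:
  fixes y t :: real
  assumes "\<bar>t\<bar> < 1"
  shows "(\<lambda>n. pochhammer y n / fact n * t ^ n) sums (1 / (1 - t)) powr y"
proof -
  have "(\<lambda>n. (- y gchoose n) * (- t) ^ n) sums (1 + - t) powr - y"
    by (rule gen_binomial_real) (use assms in simp)
  moreover have "(- y gchoose n) * (- t) ^ n = pochhammer y n / fact n * t ^ n" for n
  proof -
    have "(- 1) ^ n * (- t) ^ n = t ^ n"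
      by (metis power_mult_distrib mult_minus1 minus_minus)
    then show ?thesis
      by (simp add: gbinomial_pochhammer mult.commute mult.left_commute)
  qed
  moreover have "(1 + - t) powr - y = (1 / (1 - t)) powr y"
    using assms by (simp add: powr_minus_divide powr_divide)
  ultimately show ?thesis by simp
qed

text \<open>This licenses evaluating the \<open>THE\<close> in \<open>prob_lah\<close>. The
  difference \<open>F - G\<close> expands the zero function, whereas zeros of a nonzero power series
  are isolated.\<close>

lemma has_fps_expansion_unique:
  fixes F G :: "'a :: {real_normed_field, banach} fps"
  assumes "f has_fps_expansion F" "f has_fps_expansion G"
  shows "F = G"
proof (rule ccontr)
  assume "F \<noteq> G"
  have D: "(\<lambda>_. 0) has_fps_expansion (F - G)"
    using has_fps_expansion_diff[OF assms] by simp
  then obtain r where r: "r > 0" and zero: "\<And>z. dist z 0 < r \<Longrightarrow> eval_fps (F - G) z = 0"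
    by (auto simp: has_fps_expansion_def eventually_nhds_metric)
  define R where "R = fps_conv_radius (F - G)"
  have R: "R > 0" using D by (simp add: R_def has_fps_expansion_def)
  then obtain q where q: "q > 0" "ereal q < R"
    using ereal_dense2[of 0 R] by (auto simp: zero_ereal_def)
  have sums: "(\<lambda>n. fps_nth (F - G) n * (z - 0) ^ n) sums eval_fps (F - G) z" if "norm (z - 0) < q" for z
    using sums_eval_fps[of z "F - G"] less_trans[OF _ q(2), of "norm z"] that
    by (simp add: R_def)
  obtain m where m: "fps_nth (F - G) m \<noteq> 0"
    using \<open>F \<noteq> G\<close> by (auto simp: fps_eq_iff)
  \<comment> \<open>The constant term of \<open>F - G\<close> is its value at 0, which is 0.\<close>
  have "m > 0"
    using m zero[of 0] r by (cases m) (auto simp: eval_fps_at_0)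
  then obtain s where s: "s > 0" "\<And>z. z \<in> cball 0 s - {0} \<Longrightarrow> eval_fps (F - G) z \<noteq> 0"
    using powser_0_nonzero[OF q(1) sums _ m] zero[of 0] r by (metis dist_self)
  \<comment> \<open>A nonzero point inside both the zero-free punctured ball and the ball where
    \<open>F - G\<close> vanishes; halving \<open>r\<close> makes the second bound strict.\<close>
  define z :: 'a where "z = of_real (min s (r / 2))"
  have "z \<in> cball 0 s - {0}" "dist z 0 < r"
    using s(1) r by (auto simp: z_def)
  with s(2) zero show False by blast
qed

text \<open>The factor \<open>1 / fact m\<close> turns differentiation into an index shift. The
  shifted sum really stops before \<open>N\<close>; as \<open>c (Suc N) = 0\<close>, the range can
  stay \<open>m \<le> N\<close>, which makes the rule iterable.\<close>

lemma deriv_exponential_sum: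
  fixes c :: "nat \<Rightarrow> real"
  assumes "c (Suc N) = 0"
  shows "deriv (\<lambda>x. \<Sum>m\<le>N. c m / fact m * x ^ m) = (\<lambda>x. \<Sum>m\<le>N. c (Suc m) / fact m * x ^ m)"
proof
  fix x :: real
  have "((\<lambda>x. \<Sum>m\<le>N. c m / fact m * x ^ m) has_real_derivative
      (\<Sum>m\<le>N. c m / fact m * (real m * x ^ (m - 1)))) (at x)"
    by (auto intro!: derivative_eq_intros sum.cong)
  moreover have "(\<Sum>m\<le>N. c m / fact m * (real m * x ^ (m - 1))) = (\<Sum>m<N. c (Suc m) / fact m * x ^ m)"
    by (subst sum.atMost_shift) (auto intro!: sum.cong simp: field_simps simp del: of_nat_Suc)
  moreover have "\<dots> = (\<Sum>m\<le>N. c (Suc m) / fact m * x ^ m)"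
    using assms by (simp add: lessThan_Suc_atMost[symmetric])
  ultimately show "deriv (\<lambda>x. \<Sum>m\<le>N. c m / fact m * x ^ m) x = (\<Sum>m\<le>N. c (Suc m) / fact m * x ^ m)"
    by (metis DERIV_imp_deriv)
qed

lemma higher_deriv_exponential_sum:
  fixes c :: "nat \<Rightarrow> real"
  assumes "\<And>m. m > N \<Longrightarrow> c m = 0"
  shows "(deriv ^^ k) (\<lambda>x. \<Sum>m\<le>N. c m / fact m * x ^ m) = (\<lambda>x. \<Sum>m\<le>N. c (m + k) / fact m * x ^ m)"
proof (induction k)
  case (Suc k)
  then show ?case
    using deriv_exponential_sum[of "\<lambda>m. c (m + k)" N] assms by simp
qed simp

locale local_mgf = prob_space M for M :: "'a measure" +
  fixes Y :: "'a \<Rightarrow> real" and r :: real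
  assumes meas [measurable]: "Y \<in> borel_measurable M"
    and r_pos: "r > 0"
    and mgf: "\<And>t. \<bar>t\<bar> < r \<Longrightarrow> integrable M (\<lambda>\<omega>. exp (t * Y \<omega>))"
begin

text \<open>The constant term is kept here: the overview's series \<open>H\<close> is
  \<open>rising_moment_fps - 1\<close>.\<close>

definition rising_moment_fps :: "real fps" where
  "rising_moment_fps = Abs_fps (\<lambda>n. (\<integral>\<omega>. pochhammer (Y \<omega>) n \<partial>M) / fact n)"

text \<open>The radius \<open>1 - exp (- r)\<close> is chosen so that
  \<open>1 / (1 - \<bar>t\<bar>) = exp s\<close> with \<open>0 \<le> s < r\<close>, where the moment
  generating function exists at both \<open>s\<close> and \<open>- s\<close>.\<close>

lemma integrable_powr_abs:
  assumes "\<bar>t\<bar> < 1 - exp (- r)"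
  shows "integrable M (\<lambda>\<omega>. (1 / (1 - \<bar>t\<bar>)) powr \<bar>Y \<omega>\<bar>)"
proof -
  define s where "s = - ln (1 - \<bar>t\<bar>)"
  have t1: "\<bar>t\<bar> < 1" using assms by (smt (verit) exp_gt_zero)
  have "ln (exp (- r)) < ln (1 - \<bar>t\<bar>)"
    using assms t1 by (subst ln_less_cancel_iff) auto
  then have "ln (1 - \<bar>t\<bar>) > - r" by simp
  moreover have "ln (1 - \<bar>t\<bar>) \<le> 0" using t1 by simp
  ultimately have s: "0 \<le> s" "s < r" by (auto simp: s_def)
  have eq: "(1 / (1 - \<bar>t\<bar>)) powr y = exp (s * y)" for y
    using t1 by (simp add: powr_def s_def ln_div)
  show ?thesis unfolding eq
  proof (rule Bochner_Integration.integrable_bound)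
    show "integrable M (\<lambda>\<omega>. exp (s * Y \<omega>) + exp ((- s) * Y \<omega>))"
      by (intro Bochner_Integration.integrable_add mgf) (use s in auto)
    \<comment> \<open>The left side equals one of the two positive summands, depending on the sign
      of \<open>Y \<omega>\<close>.\<close>
    show "AE \<omega> in M. norm (exp (s * \<bar>Y \<omega>\<bar>)) \<le> norm (exp (s * Y \<omega>) + exp ((- s) * Y \<omega>))"
      by (intro AE_I2) (simp add: abs_of_pos add_pos_pos, simp add: abs_if)
  qed simp
qed

lemma rising_moment_series:
  assumes t: "\<bar>t\<bar> < 1 - exp (- r)"
  shows "(\<lambda>n. (\<integral>\<omega>. pochhammer (Y \<omega>) n \<partial>M) / fact n * t ^ n) sums (\<integral>\<omega>. (1 / (1 - t)) powr Y \<omega> \<partial>M)"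
proof -
  define f where "f = (\<lambda>n \<omega>. pochhammer (Y \<omega>) n / fact n * t ^ n)"
  define D where "D = (\<lambda>\<omega>. (1 / (1 - \<bar>t\<bar>)) powr \<bar>Y \<omega>\<bar>)"
  have t1: "\<bar>t\<bar> < 1" using t by (smt (verit) exp_gt_zero)
  have D: "integrable M D" unfolding D_def by (rule integrable_powr_abs[OF t])
  have f_meas [measurable]: "f n \<in> borel_measurable M" for n
    unfolding f_def pochhammer_prod by measurable
  have maj: "(\<lambda>n. pochhammer \<bar>Y \<omega>\<bar> n / fact n * \<bar>t\<bar> ^ n) sums D \<omega>" for \<omega>
    unfolding D_def by (rule pochhammer_series_sums) (use t1 in simp)
  have le: "norm (f n \<omega>) \<le> pochhammer \<bar>Y \<omega>\<bar> n / fact n * \<bar>t\<bar> ^ n" for n \<omega>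
    unfolding f_def by (auto simp: abs_mult power_abs intro!: mult_right_mono divide_right_mono abs_pochhammer_le)
  have summ: "summable (\<lambda>n. norm (f n \<omega>))" for \<omega>
    by (rule summable_comparison_test'[OF sums_summable[OF maj[of \<omega>]], of 0]) (use le in simp)
  \<comment> \<open>Singletons \<open>I\<close> give integrability of each term, initial segments
    the bound on the summed integrals.\<close>
  have partial: "(\<Sum>i\<in>I. norm (f i \<omega>)) \<le> D \<omega>" if "finite I" for I \<omega>
  proof -
    have "(\<Sum>i\<in>I. norm (f i \<omega>)) \<le> (\<Sum>i\<in>I. pochhammer \<bar>Y \<omega>\<bar> i / fact i * \<bar>t\<bar> ^ i)"
      by (intro sum_mono le)
    also have "\<dots> \<le> D \<omega>"
      using sum_le_suminf[OF sums_summable[OF maj[of \<omega>]] that] sums_unique[OF maj[of \<omega>]] order_trans[OF norm_ge_zero le]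
      by simp
    finally show ?thesis .
  qed
  have f_int: "integrable M (f n)" for n
    by (rule Bochner_Integration.integrable_bound[OF D]) (use partial[of "{n}"] in \<open>auto simp: D_def\<close>)
  \<comment> \<open>This is what exchanging sum and integral requires; the partial sums are bounded
    by the expectation of \<open>D\<close>.\<close>
  have "summable (\<lambda>n. \<integral>\<omega>. norm (f n \<omega>) \<partial>M)"
  proof (rule summableI_nonneg_bounded)
    fix n
    have "(\<Sum>i<n. \<integral>\<omega>. norm (f i \<omega>) \<partial>M) = (\<integral>\<omega>. (\<Sum>i<n. norm (f i \<omega>)) \<partial>M)"
      by (subst Bochner_Integration.integral_sum) (use f_int in auto)
    also have "\<dots> \<le> integral\<^sup>L M D"
      by (intro integral_mono D Bochner_Integration.integrable_sum integrable_norm f_int partial) auto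
    finally show "(\<Sum>i<n. \<integral>\<omega>. norm (f i \<omega>) \<partial>M) \<le> integral\<^sup>L M D" .
  qed auto
  then have "(\<lambda>n. integral\<^sup>L M (f n)) sums (\<integral>\<omega>. (\<Sum>n. f n \<omega>) \<partial>M)"
    by (intro sums_integral f_int AE_I2 summ)
  moreover have "(\<Sum>n. f n \<omega>) = (1 / (1 - t)) powr Y \<omega>" for \<omega>
    unfolding f_def using pochhammer_series_sums[OF t1] by (simp add: sums_iff)
  ultimately show "(\<lambda>n. (\<integral>\<omega>. pochhammer (Y \<omega>) n \<partial>M) / fact n * t ^ n) sums (\<integral>\<omega>. (1 / (1 - t)) powr Y \<omega> \<partial>M)"
    by (simp add: f_def)
qed

lemma has_fps_expansion_rising_moment:
  "(\<lambda>t. \<integral>\<omega>. (1 / (1 - t)) powr Y \<omega> \<partial>M) has_fps_expansion rising_moment_fps"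
proof -
  define R where "R = 1 - exp (- r)"
  have R: "R > 0" using r_pos by (simp add: R_def)
  have sums: "(\<lambda>n. fps_nth rising_moment_fps n * t ^ n) sums (\<integral>\<omega>. (1 / (1 - t)) powr Y \<omega> \<partial>M)"
    if "\<bar>t\<bar> < R" for t
    using rising_moment_series[of t] that by (simp add: rising_moment_fps_def R_def)
  \<comment> \<open>Convergence at the single point \<open>R / 2\<close> already bounds the radius
    of convergence from below.\<close>
  have "ereal (norm (R / 2)) \<le> fps_conv_radius rising_moment_fps"
    unfolding fps_conv_radius_def
    by (rule conv_radius_geI, rule sums_summable, rule sums) (use R in auto)
  then have "fps_conv_radius rising_moment_fps > 0"
    using R by (intro less_le_trans[OF _ \<open>ereal _ \<le> _\<close>]) (auto simp: zero_ereal_def)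
  moreover have "eventually (\<lambda>t. \<bar>t\<bar> < R) (nhds (0 :: real))"
    using R by (auto simp: eventually_nhds_metric dist_real_def)
  then have "eventually (\<lambda>t. eval_fps rising_moment_fps t = (\<integral>\<omega>. (1 / (1 - t)) powr Y \<omega> \<partial>M)) (nhds 0)"
    by eventually_elim (use sums in \<open>auto simp: eval_fps_def sums_iff\<close>)
  ultimately show ?thesis by (simp add: has_fps_expansion_def)
qed

lemma rising_moment_fps_0: "fps_nth rising_moment_fps 0 = 1"
  by (simp add: rising_moment_fps_def prob_space)

text \<open>From here on the argument is purely about formal power series.\<close>

lemma prob_lah_eq: "prob_lah M Y n k = fact n * fps_nth ((rising_moment_fps - 1) ^ k) n / fact k"
proof -
  define H where "H = fps_const (1 / fact k) * (rising_moment_fps - 1) ^ k"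
  let ?h = "\<lambda>t. 1 / fact k * ((\<integral>\<omega>. (1 / (1 - t)) powr Y \<omega> \<partial>M) - 1) ^ k"
  have H: "?h has_fps_expansion H"
    unfolding H_def by (intro fps_expansion_intros has_fps_expansion_rising_moment)
  then have "(THE F. ?h has_fps_expansion F) = H"
    by (blast intro: has_fps_expansion_unique)
  then show ?thesis by (simp add: prob_lah_def H_def)
qed

text \<open>The base has no constant term, so its \<open>k\<close>-th power is divisible by the
  \<open>k\<close>-th power of the variable.\<close>

lemma power_nth_eq_0: "n < k \<Longrightarrow> fps_nth ((rising_moment_fps - 1) ^ k) n = 0"
  using startsby_zero_power_prefix[of "rising_moment_fps - 1" k] rising_moment_fps_0 by simp

text \<open>A common upper limit \<open>N\<close> for all \<open>n \<le> N\<close> lets the sums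
  over \<open>m\<close> and \<open>j\<close> be swapped later.\<close>

lemma prob_lah_bell_eq:
  assumes "n \<le> N"
  shows "prob_lah_bell M Y n x =
    (\<Sum>m\<le>N. fact n * fps_nth ((rising_moment_fps - 1) ^ m) n / fact m * x ^ m)"
  unfolding prob_lah_bell_def prob_lah_eq
  by (rule sum.mono_neutral_left) (use assms power_nth_eq_0 in auto)

lemma higher_deriv_prob_lah_bell:
  assumes "k \<le> n"
  shows "(deriv ^^ k) (prob_lah_bell M Y n) x =
    fact k * (\<Sum>j=0..n-k. real (n choose j) * prob_lah_bell M Y j x * prob_lah M Y (n - j) k)"
proof -
  define H where "H = rising_moment_fps - 1"
  have "(deriv ^^ k) (prob_lah_bell M Y n) x =
      (\<Sum>m\<le>n. fact n * fps_nth (H ^ (m + k)) n / fact m * x ^ m)"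
    unfolding prob_lah_bell_eq[OF order_refl] H_def
    by (subst higher_deriv_exponential_sum) (auto simp: power_nth_eq_0)
  \<comment> \<open>Cauchy product of \<open>H ^ m\<close> and \<open>H ^ k\<close>.\<close>
  also have "\<dots> = (\<Sum>m\<le>n. \<Sum>j=0..n. fact n * (fps_nth (H ^ m) j * fps_nth (H ^ k) (n - j)) / fact m * x ^ m)"
    by (simp add: power_add fps_mult_nth sum_distrib_left sum_distrib_right sum_divide_distrib)
  also have "\<dots> = (\<Sum>j=0..n. \<Sum>m\<le>n. fact n * (fps_nth (H ^ m) j * fps_nth (H ^ k) (n - j)) / fact m * x ^ m)"
    by (rule sum.swap)
  also have "\<dots> = (\<Sum>j=0..n. fact k * (real (n choose j) * prob_lah_bell M Y j x * prob_lah M Y (n - j) k))"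
  proof (intro sum.cong refl)
    fix j assume "j \<in> {0..n}"
    then have j: "j \<le> n" by simp
    define S where "S = (\<Sum>m\<le>n. fps_nth (H ^ m) j / fact m * x ^ m)"
    have "prob_lah_bell M Y j x = fact j * S"
      unfolding prob_lah_bell_eq[OF j] S_def H_def sum_distrib_left by (simp add: mult.assoc)
    \<comment> \<open>The binomial coefficient cancels \<open>fact j\<close> and
      \<open>fact (n - j)\<close>, leaving \<open>fact n\<close>; \<open>fact k\<close> cancels the
      denominator in \<open>prob_lah\<close>.\<close>
    then have "fact k * (real (n choose j) * prob_lah_bell M Y j x * prob_lah M Y (n - j) k)
        = fact n * S * fps_nth (H ^ k) (n - j)"
      by (simp add: prob_lah_eq H_def binomial_fact[OF j])
    also have "\<dots> = (\<Sum>m\<le>n. fact n * (fps_nth (H ^ m) j * fps_nth (H ^ k) (n - j)) / fact m * x ^ m)"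
      unfolding S_def sum_distrib_left sum_distrib_right by (intro sum.cong) simp_all
    finally show "(\<Sum>m\<le>n. fact n * (fps_nth (H ^ m) j * fps_nth (H ^ k) (n - j)) / fact m * x ^ m)
        = fact k * (real (n choose j) * prob_lah_bell M Y j x * prob_lah M Y (n - j) k)" ..
  qed
  \<comment> \<open>For \<open>j > n - k\<close> we have \<open>n - j < k\<close>, so the Lah number
    vanishes.\<close>
  also have "\<dots> = (\<Sum>j=0..n-k. fact k * (real (n choose j) * prob_lah_bell M Y j x * prob_lah M Y (n - j) k))"
    by (rule sum.mono_neutral_right) (use assms in \<open>auto simp: prob_lah_eq power_nth_eq_0\<close>)
  finally show ?thesis by (simp add: sum_distrib_left)
qed

text \<open>Subtracting 1 from the series changes only the coefficient at index 0.\<close>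

lemma prob_lah_1: "n \<ge> 1 \<Longrightarrow> prob_lah M Y n 1 = (\<integral>\<omega>. pochhammer (Y \<omega>) n \<partial>M)"
  by (simp add: prob_lah_eq rising_moment_fps_def)

end

theorem theorem2p11:
  fixes M :: "'a measure" and Y :: "'a \<Rightarrow> real" and r :: real
  assumes "prob_space M"
    and "Y \<in> borel_measurable M"
    and "r > 0"
    and "\<And>t. \<bar>t\<bar> < r \<Longrightarrow> integrable M (\<lambda>\<omega>. exp (t * Y \<omega>))"
  shows "(\<forall>n k x. k \<le> n \<longrightarrow>
            (deriv ^^ k) (prob_lah_bell M Y n) x =
              fact k * (\<Sum>j=0..n-k. real (n choose j) * prob_lah_bell M Y j x * prob_lah M Y (n - j) k)) \<and>
         (\<forall>n x. 1 \<le> n \<longrightarrow>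
            deriv (prob_lah_bell M Y n) x =
              (\<Sum>j=0..n-1. real (n choose j) * (\<integral>\<omega>. pochhammer (Y \<omega>) (n - j) \<partial>M) * prob_lah_bell M Y j x))"
proof (intro conjI allI impI)
  interpret local_mgf M Y r
    by (intro local_mgf.intro local_mgf_axioms.intro assms)
  fix n k :: nat and x :: real
  assume "k \<le> n"
  then show "(deriv ^^ k) (prob_lah_bell M Y n) x =
      fact k * (\<Sum>j=0..n-k. real (n choose j) * prob_lah_bell M Y j x * prob_lah M Y (n - j) k)"
    by (rule higher_deriv_prob_lah_bell)
next
  interpret local_mgf M Y r
    by (intro local_mgf.intro local_mgf_axioms.intro assms)
  fix n :: nat and x :: real
  assume n: "1 \<le> n"
  have "deriv (prob_lah_bell M Y n) x =
      (\<Sum>j=0..n-1. real (n choose j) * prob_lah_bell M Y j x * prob_lah M Y (n - j) 1)"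
    using higher_deriv_prob_lah_bell[OF n] by simp
  also have "\<dots> = (\<Sum>j=0..n-1. real (n choose j) * (\<integral>\<omega>. pochhammer (Y \<omega>) (n - j) \<partial>M) * prob_lah_bell M Y j x)"
    by (intro sum.cong refl, subst prob_lah_1) (use n in auto)
  finally show "deriv (prob_lah_bell M Y n) x =
      (\<Sum>j=0..n-1. real (n choose j) * (\<integral>\<omega>. pochhammer (Y \<omega>) (n - j) \<partial>M) * prob_lah_bell M Y j x)" .
qed

end
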